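(* Let $\sigma>0$, $\varepsilon>0$, $\Delta x>0$, $\Delta t>0$. Consider the ImEx1-ctr scheme together with either periodic boundary conditions or hybrid Dirichlet–Neumann boundary conditions (with imposed boundary values $E_L,E_R$), and set $u_j^n=E_j^n+F_j^n$, $v_j^n=E_j^n-F_j^n$. Then the scheme is $l^\infty$-diminishing for the variables $u,v$, that is, $$\max_{1\le j\le N}\left(|u_j^{n+1}|,|v_j^{n+1}|\right)\le \max_{1\le j\le N}\left(|u_j^{n}|,|v_j^{n}|\right),$$ under the condition $$\Delta t_{min}:=\frac{\varepsilon\Delta x}{2}\ \le\ \Delta t\ \le\ \Delta t_{max}:=\frac{\sigma\Delta x^2}{4}\cdot\frac{1+\sqrt{1+2\left(\frac{4\varepsilon}{\sigma\Delta x}\right)^2}}{2}.$$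
   Context: The unknowns are real grid values $E_j^n,F_j^n$ with cells $1\le j\le N$ and time levels $n\ge 0$; $\sigma$ is constant, $\Delta x$ is the mesh size and $\Delta t$ the time step. Put $M=\frac{1}{1+\sigma\Delta t/\varepsilon^2}$. The ImEx1-ctr scheme (for the hyperbolic heat equations $\partial_tE+\frac1\varepsilon\partial_xF=0$, $\partial_tF+\frac1\varepsilon\partial_xE=-\frac{\sigma}{\varepsilon^2}F$) is, for $1\le j\le N$, $n\ge 0$, $$\frac{E_j^{n+1}-E_j^n}{\Delta t}+\frac{M}{\varepsilon}\frac{F_{j+1}^n-F_{j-1}^n}{2\Delta x}-\frac{M\Delta t}{\varepsilon^2}\frac{E_{j+1}^n-2E_j^n+E_{j-1}^n}{\Delta x^2}=0,$$ $$\frac{F_j^{n+1}-F_j^n}{\Delta t}+\frac{M}{\varepsilon}\frac{E_{j+1}^n-E_{j-1}^n}{2\Delta x}-\frac{M\Delta t}{\varepsilon^2}\frac{F_{j+1}^n-2F_j^n+F_{j-1}^n}{\Delta x^2}=-\frac{M\sigma}{\varepsilon^2}F_j^n.$$ The ghost values at $j=0$ and $j=N+1$ are given, at each time level $n$, by the boundary conditions. Periodic: $E_0^n=E_N^n$, $F_0^n=F_N^n$, $E_{N+1}^n=E_1^n$, $F_{N+1}^n=F_1^n$. Hybrid Dirichlet–Neumann: $\frac{E_0^n+E_1^n}{2}=E_L$, $\frac{F_1^n-F_0^n}{\Delta x}=0$, $\frac{E_N^n+E_{N+1}^n}{2}=E_R$, $\frac{F_{N+1}^n-F_N^n}{\Delta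 x}=0$, where $E_L,E_R$ are the constant values imposed on $E$ at the left and right boundaries.
   Formalization: For hybrid boundary conditions the inequality is stated only when E_L = E_R = 0, since zero data with nonzero boundary values violates it; for general E_L, E_R the maximum at time n is also taken over the ghost cells j = 0 and j = N+1. *)

theory Defs
  imports Complex_Main
begin

text \<open>Grid functions have type \<^typ>\<open>nat \<Rightarrow> nat \<Rightarrow> real\<close>: \<open>E n j\<close> is the value at time
  level \<open>n\<close> in cell \<open>j\<close>. The cells are \<open>1..N\<close>; the indices \<open>0\<close> and \<open>N + 1\<close> are the ghost
  cells; values at indices beyond \<open>N + 1\<close> play no role.\<close>

definition relax_M :: "real \<Rightarrow> real \<Rightarrow> real \<Rightarrow> real" where
  "relax_M \<sigma> \<epsilon> dt = 1 / (1 + \<sigma> * dt / \<epsilon>^2)"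

definition imex1_ctr ::
  "nat \<Rightarrow> real \<Rightarrow> real \<Rightarrow> real \<Rightarrow> real \<Rightarrow> (nat \<Rightarrow> nat \<Rightarrow> real) \<Rightarrow> (nat \<Rightarrow> nat \<Rightarrow> real) \<Rightarrow> bool" where
  "imex1_ctr N \<sigma> \<epsilon> dx dt E F \<longleftrightarrow>
    (let M = relax_M \<sigma> \<epsilon> dt in
     \<forall>n. \<forall>j\<in>{1..N}.
       (E (Suc n) j - E n j) / dt
         + M / \<epsilon> * ((F n (j + 1) - F n (j - 1)) / (2 * dx))
         - M * dt / \<epsilon>^2 * ((E n (j + 1) - 2 * E n j + E n (j - 1)) / dx^2) = 0 \<and>
       (F (Suc n) j - F n j) / dt
         + M / \<epsilon> * ((E n (j + 1) - E n (j - 1)) / (2 * dx))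
         - M * dt / \<epsilon>^2 * ((F n (j + 1) - 2 * F n j + F n (j - 1)) / dx^2)
         = - (M * \<sigma> / \<epsilon>^2) * F n j)"

definition periodic_bc :: "nat \<Rightarrow> (nat \<Rightarrow> nat \<Rightarrow> real) \<Rightarrow> (nat \<Rightarrow> nat \<Rightarrow> real) \<Rightarrow> bool" where
  "periodic_bc N E F \<longleftrightarrow>
    (\<forall>n. E n 0 = E n N \<and> F n 0 = F n N \<and> E n (N + 1) = E n 1 \<and> F n (N + 1) = F n 1)"

definition hybrid_bc ::
  "nat \<Rightarrow> real \<Rightarrow> real \<Rightarrow> real \<Rightarrow> (nat \<Rightarrow> nat \<Rightarrow> real) \<Rightarrow> (nat \<Rightarrow> nat \<Rightarrow> real) \<Rightarrow> bool" where
  "hybrid_bc N dx E\<^sub>L E\<^sub>R E F \<longleftrightarrow>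
    (\<forall>n. (E n 0 + E n 1) / 2 = E\<^sub>L \<and> (F n 1 - F n 0) / dx = 0 \<and>
         (E n N + E n (N + 1)) / 2 = E\<^sub>R \<and> (F n (N + 1) - F n N) / dx = 0)"

definition dt_min :: "real \<Rightarrow> real \<Rightarrow> real" where
  "dt_min \<epsilon> dx = \<epsilon> * dx / 2"

definition dt_max :: "real \<Rightarrow> real \<Rightarrow> real \<Rightarrow> real" where
  "dt_max \<sigma> \<epsilon> dx = \<sigma> * dx^2 / 4 * ((1 + sqrt (1 + 2 * (4 * \<epsilon> / (\<sigma> * dx))^2)) / 2)"

end

theory Submission
  imports Defs
begin

text \<open>In the variables \<open>u = E + F\<close> and \<open>v = E - F\<close> the scheme writes each new value as a
  combination of three neighbouring values of the same variable and the central value of the other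
  one, with coefficients summing to \<open>1\<close>. The lower bound on the time step is exactly the
  nonnegativity of the downwind coefficient, the upper bound exactly that of the central coefficient,
  so under both bounds the combination is convex. In the periodic case the ghost values are interior
  values; in the hybrid case with vanishing boundary data the ghost values of \<open>u\<close> are, up to sign,
  interior values of \<open>v\<close>, and vice versa.\<close>

lemma abs_convex_combination4_le:
  fixes K :: real
  assumes "0 \<le> a" "0 \<le> b" "0 \<le> c" "0 \<le> d" "a + b + c + d = 1"
    and "\<bar>w\<bar> \<le> K" "\<bar>x\<bar> \<le> K" "\<bar>y\<bar> \<le> K" "\<bar>z\<bar> \<le> K"
  shows "\<bar>a * w + b * x + c * y + d * z\<bar> \<le> K"
proof -
  have "\<bar>a * w + b * x + c * y + d * z\<bar> \<le> \<bar>a * w\<bar> + \<bar>b * x\<bar> + \<bar>c * y\<bar> + \<bar>d * z\<bar>"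
    by linarith
  also have "\<dots> \<le> a * K + b * K + c * K + d * K"
    using assms by (intro add_mono) (simp_all add: abs_mult mult_left_mono)
  also have "\<dots> = (a + b + c + d) * K" by (simp add: algebra_simps)
  finally show ?thesis using assms by simp
qed

text \<open>\<open>dt_max\<close> is the larger root of the quadratic in \<open>dt\<close> obtained
  by turning the conclusion into an equality. The smaller root is at most 0, so a positive
  \<open>dt\<close> up to \<open>dt_max\<close> lies between the roots.\<close>

lemma dt_max_quadratic:
  assumes "\<sigma> > 0" "dx > 0" "dt > 0" "dt \<le> dt_max \<sigma> \<epsilon> dx"
  shows "2 * dt^2 \<le> \<epsilon>^2 * dx^2 + \<sigma> * dt * dx^2 / 2"
proof -
  \<comment> \<open>The roots are \<open>K - K * s\<close> and \<open>K + K * s\<close>; completing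
    the square around the midpoint \<open>K\<close> gives the claim.\<close>
  define K where "K = \<sigma> * dx^2 / 8"
  define s where "s = sqrt (1 + 2 * (4 * \<epsilon> / (\<sigma> * dx))^2)"
  have K: "K > 0" using assms by (simp add: K_def)
  have s1: "s \<ge> 1" by (simp add: s_def)
  have s2: "s^2 = 1 + 2 * (4 * \<epsilon> / (\<sigma> * dx))^2" by (simp add: s_def)
  have Ks: "K^2 * s^2 = K^2 + \<epsilon>^2 * dx^2 / 2"
    unfolding s2 using assms by (simp add: K_def field_simps power2_eq_square)
  have "K \<le> K * s" using K s1 by simp
  moreover have "dt \<le> K + K * s"
    using assms(4) by (simp add: dt_max_def K_def s_def algebra_simps)
  ultimately have "\<bar>dt - K\<bar> \<le> K * s" using assms(3) by linarith
  then have "(dt - K)^2 \<le> (K * s)^2" using abs_le_square_iff by fastforce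
  then have "dt^2 - 2 * K * dt \<le> \<epsilon>^2 * dx^2 / 2"
    by (simp add: power2_diff power_mult_distrib Ks algebra_simps)
  then show ?thesis by (simp add: K_def algebra_simps)
qed

text \<open>Purely local: only the three stencil cells need the bound \<open>K\<close>, so boundary
  conditions enter later, through the choice of \<open>K\<close> alone.\<close>

lemma imex1_ctr_abs_step_le:
  fixes E F :: "nat \<Rightarrow> nat \<Rightarrow> real"
  assumes pos: "\<sigma> > 0" "\<epsilon> > 0" "dx > 0" "dt > 0"
    and scheme: "imex1_ctr N \<sigma> \<epsilon> dx dt E F"
    and lower: "dt_min \<epsilon> dx \<le> dt" and upper: "dt \<le> dt_max \<sigma> \<epsilon> dx"
    and j: "j \<in> {1..N}"
    and bound: "\<And>i. i \<in> {j - 1, j, j + 1} \<Longrightarrow> \<bar>E n i + F n i\<bar> \<le> K \<and> \<bar>E n i - F n i\<bar> \<le> K"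
  shows "\<bar>E (Suc n) j + F (Suc n) j\<bar> \<le> K \<and> \<bar>E (Suc n) j - F (Suc n) j\<bar> \<le> K"
proof -
  \<comment> \<open>Dimensionless weights over the common denominator of \<open>M\<close>:
    \<open>a\<close> for transport, \<open>b\<close> for diffusion, \<open>2 * c\<close> for
    relaxation.\<close>
  define D where "D = \<epsilon>^2 + \<sigma> * dt"
  define a where "a = \<epsilon> * dt / (2 * dx * D)"
  define b where "b = dt^2 / (dx^2 * D)"
  define c where "c = \<sigma> * dt / (2 * D)"
  define M where "M = relax_M \<sigma> \<epsilon> dt"
  have D: "D > 0" using pos by (simp add: D_def add_pos_pos)
  have M: "M = \<epsilon>^2 / D" using pos D by (simp add: M_def relax_M_def D_def field_simps)
  have a0: "0 \<le> a" and c0: "0 \<le> c" using pos D by (simp_all add: a_def c_def)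
  have ba: "0 \<le> b - a"
  proof -
    have "b - a = dt / (dx^2 * D) * (dt - \<epsilon> * dx / 2)"
      using pos D by (simp add: a_def b_def field_simps power2_eq_square)
    then show ?thesis using pos D lower by (simp add: dt_min_def)
  qed
  have centre: "0 \<le> 1 - 2 * b - c"
  proof -
    have "1 - 2 * b - c = (D * dx^2 - 2 * dt^2 - \<sigma> * dt * dx^2 / 2) / (dx^2 * D)"
      using pos D by (simp add: b_def c_def field_simps)
    moreover have "0 \<le> D * dx^2 - 2 * dt^2 - \<sigma> * dt * dx^2 / 2"
      using dt_max_quadratic[OF pos(1,3,4) upper] by (simp add: D_def algebra_simps)
    ultimately show ?thesis using D by simp
  qed
  \<comment> \<open>Each term becomes a weight over \<open>dt\<close>, so that \<open>dt\<close>
    cancels from the whole equation.\<close>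
  have Ma: "M / \<epsilon> * (x / (2 * dx)) = a * x / dt" for x
    using pos D by (simp add: M a_def field_simps power2_eq_square)
  have Mb: "M * dt / \<epsilon>^2 * (x / dx^2) = b * x / dt" for x
    using pos D by (simp add: M b_def field_simps power2_eq_square)
  have Mc: "M * \<sigma> / \<epsilon>^2 * x = 2 * c * x / dt" for x
    using pos D by (simp add: M c_def field_simps)
  have eqs: "(E (Suc n) j - E n j) / dt
         + M / \<epsilon> * ((F n (j + 1) - F n (j - 1)) / (2 * dx))
         - M * dt / \<epsilon>^2 * ((E n (j + 1) - 2 * E n j + E n (j - 1)) / dx^2) = 0"
    "(F (Suc n) j - F n j) / dt
         + M / \<epsilon> * ((E n (j + 1) - E n (j - 1)) / (2 * dx))
         - M * dt / \<epsilon>^2 * ((F n (j + 1) - 2 * F n j + F n (j - 1)) / dx^2)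
         = - (M * \<sigma> / \<epsilon>^2 * F n j)"
    using scheme j by (auto simp: imex1_ctr_def Let_def M_def)
  have E: "E (Suc n) j = E n j - a * (F n (j + 1) - F n (j - 1))
      + b * (E n (j + 1) - 2 * E n j + E n (j - 1))"
    using eqs(1) pos(4) unfolding Ma Mb
    by (simp flip: add_divide_distrib diff_divide_distrib)
  have F: "F (Suc n) j = F n j - a * (E n (j + 1) - E n (j - 1))
      + b * (F n (j + 1) - 2 * F n j + F n (j - 1)) - 2 * c * F n j"
    using eqs(2) pos(4) unfolding Ma Mb Mc
    by (simp add: divide_eq_eq flip: add_divide_distrib diff_divide_distrib)
  \<comment> \<open>Since \<open>2 * F\<close> is \<open>u - v\<close>, relaxation moves the weight
    \<open>c\<close> from the central value of one variable to that of the other, and the weights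
    still sum to 1.\<close>
  have u: "E (Suc n) j + F (Suc n) j = (b - a) * (E n (j + 1) + F n (j + 1))
      + (b + a) * (E n (j - 1) + F n (j - 1)) + (1 - 2 * b - c) * (E n j + F n j)
      + c * (E n j - F n j)"
    unfolding E F by (simp add: algebra_simps)
  have v: "E (Suc n) j - F (Suc n) j = (b + a) * (E n (j + 1) - F n (j + 1))
      + (b - a) * (E n (j - 1) - F n (j - 1)) + (1 - 2 * b - c) * (E n j - F n j)
      + c * (E n j + F n j)"
    unfolding E F by (simp add: algebra_simps)
  show ?thesis
    unfolding u v using a0 ba c0 centre bound
    by (intro conjI abs_convex_combination4_le) auto
qed

text \<open>With nonzero boundary data the interior maximum can grow: zero cell values with
  \<open>E\<^sub>L\<close> nonzero give a nonzero ghost value, which enters cell 1 at the next step.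
  The bound covering all data therefore includes the ghost cells on its right-hand side.\<close>

theorem theorem4p1:
  fixes N :: nat
    and \<sigma> \<epsilon> dx dt E\<^sub>L E\<^sub>R :: real
    and E F u v :: "nat \<Rightarrow> nat \<Rightarrow> real"
  assumes "N \<ge> 1"
    and "\<sigma> > 0" and "\<epsilon> > 0" and "dx > 0" and "dt > 0"
    and "imex1_ctr N \<sigma> \<epsilon> dx dt E F"
    and "periodic_bc N E F \<or> hybrid_bc N dx E\<^sub>L E\<^sub>R E F"
    and "\<And>n j. u n j = E n j + F n j"
    and "\<And>n j. v n j = E n j - F n j"
    and "dt_min \<epsilon> dx \<le> dt" and "dt \<le> dt_max \<sigma> \<epsilon> dx"
  shows "(periodic_bc N E F \<or> (E\<^sub>L = 0 \<and> E\<^sub>R = 0) \<longrightarrow>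
           (\<forall>n. (MAX j\<in>{1..N}. max \<bar>u (Suc n) j\<bar> \<bar>v (Suc n) j\<bar>)
                \<le> (MAX j\<in>{1..N}. max \<bar>u n j\<bar> \<bar>v n j\<bar>))) \<and>
         (\<forall>n. (MAX j\<in>{1..N}. max \<bar>u (Suc n) j\<bar> \<bar>v (Suc n) j\<bar>)
              \<le> (MAX j\<in>{0..N + 1}. max \<bar>u n j\<bar> \<bar>v n j\<bar>))"
proof -
  have step: "(MAX j\<in>{1..N}. max \<bar>u (Suc n) j\<bar> \<bar>v (Suc n) j\<bar>) \<le> K"
    if "\<And>i. i \<in> {0..N + 1} \<Longrightarrow> max \<bar>u n i\<bar> \<bar>v n i\<bar> \<le> K" for n K
  proof -
    have bound: "\<bar>E n i + F n i\<bar> \<le> K \<and> \<bar>E n i - F n i\<bar> \<le> K" if "i \<in> {0..N + 1}" for i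
      using \<open>\<And>i. i \<in> {0..N + 1} \<Longrightarrow> max \<bar>u n i\<bar> \<bar>v n i\<bar> \<le> K\<close>[OF that] assms(8,9) by simp
    have "max \<bar>u (Suc n) j\<bar> \<bar>v (Suc n) j\<bar> \<le> K" if "j \<in> {1..N}" for j
    proof -
      have "i \<in> {0..N + 1}" if "i \<in> {j - 1, j, j + 1}" for i
        using that \<open>j \<in> {1..N}\<close> by auto
      then show ?thesis
        using imex1_ctr_abs_step_le[OF assms(2-6,10,11) that, of n K] bound assms(8,9) by simp
    qed
    then show ?thesis using assms(1) by (subst Max_le_iff) auto
  qed
  have ghosts: "(MAX j\<in>{1..N}. max \<bar>u (Suc n) j\<bar> \<bar>v (Suc n) j\<bar>)
      \<le> (MAX j\<in>{0..N + 1}. max \<bar>u n j\<bar> \<bar>v n j\<bar>)" for n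
    by (intro step Max_ge) auto
  have interior: "(MAX j\<in>{1..N}. max \<bar>u (Suc n) j\<bar> \<bar>v (Suc n) j\<bar>)
      \<le> (MAX j\<in>{1..N}. max \<bar>u n j\<bar> \<bar>v n j\<bar>)"
    if bc: "periodic_bc N E F \<or> (E\<^sub>L = 0 \<and> E\<^sub>R = 0)" for n
  proof (rule step)
    fix i assume i: "i \<in> {0..N + 1}"
    have "\<exists>k\<in>{1..N}. max \<bar>u n i\<bar> \<bar>v n i\<bar> = max \<bar>u n k\<bar> \<bar>v n k\<bar>"
    proof (cases "i \<in> {1..N}")
      case False
      then have i: "i = 0 \<or> i = N + 1" using i by auto
      show ?thesis
      proof (cases "periodic_bc N E F")
        case True
        then have "u n 0 = u n N" "v n 0 = v n N" "u n (N + 1) = u n 1" "v n (N + 1) = v n 1"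
          using assms(8,9) by (auto simp: periodic_bc_def)
        moreover have "1 \<in> {1..N}" "N \<in> {1..N}" using assms(1) by auto
        ultimately show ?thesis using i by metis
      next
        case False
        then have h: "hybrid_bc N dx 0 0 E F" using assms(7) bc by auto
        have "E n 0 = - E n 1" "F n 0 = F n 1" "E n (N + 1) = - E n N" "F n (N + 1) = F n N"
          using h[unfolded hybrid_bc_def, rule_format, of n] assms(4) by simp_all
        \<comment> \<open>Reflection is odd in \<open>E\<close> and even in \<open>F\<close>, so
          \<open>u n 0 = - v n 1\<close> and \<open>v n 0 = - u n 1\<close>; the maximum of absolute
          values is unchanged by this swap.\<close>
        then have "max \<bar>u n 0\<bar> \<bar>v n 0\<bar> = max \<bar>u n 1\<bar> \<bar>v n 1\<bar>"
          "max \<bar>u n (N + 1)\<bar> \<bar>v n (N + 1)\<bar> = max \<bar>u n N\<bar> \<bar>v n N\<bar>"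
          unfolding assms(8,9) by linarith+
        moreover have "1 \<in> {1..N}" "N \<in> {1..N}" using assms(1) by auto
        ultimately show ?thesis using i by metis
      qed
    qed auto
    then have "max \<bar>u n i\<bar> \<bar>v n i\<bar> \<in> (\<lambda>j. max \<bar>u n j\<bar> \<bar>v n j\<bar>) ` {1..N}"
      by (simp only: image_iff)
    then show "max \<bar>u n i\<bar> \<bar>v n i\<bar> \<le> (MAX j\<in>{1..N}. max \<bar>u n j\<bar> \<bar>v n j\<bar>)"
      by (intro Max_ge) simp_all
  qed
  show ?thesis using interior ghosts by blast
qed

end
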